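(* Let $X$ be a compact metric space and let $T:X\to X$ be a continuous map. Suppose that the set $\mathcal{M}_p$ of $T$-periodic measures is dense in the space $\mathcal{M}(T)$ of $T$-invariant Borel probability measures on $X$, endowed with the weak topology. Then, for each $s\in(0,1)$, the set $$FD=\{\mu\in \mathcal{M}(T)\mid D^-_{\mu}(s)=0\}$$ is a residual subset of $\mathcal{M}(T)$.
   Context: $\mathcal{M}(T)$ carries the weak topology ($\mu_\alpha\to\mu$ iff $\int f\,d\mu_\alpha\to\int f\,d\mu$ for every bounded continuous $f:X\to\mathbb{R}$). $\mathcal{M}_p$ is the set of measures of the form $\mu_x=\frac{1}{k_x}\sum_{i=0}^{k_x-1}\delta_{T^i x}$, where $x\in X$ is a $T$-periodic point of period $k_x$. For a Borel probability measure $\mu$ on $X$, $q\in(0,\infty)\setminus\{1\}$ and $\varepsilon\in(0,1)$, let $I_\mu(q,\varepsilon)=\int_{\operatorname{supp}(\mu)}\mu(B(x,\varepsilon))^{q-1}\,d\mu(x)$, where $B(x,\varepsilon)$ is the open ball and $\operatorname{supp}(\mu)$ the topological support. The lower $q$-generalized fractal dimension is $D^-_\mu(q)=\liminf_{\varepsilon\downarrow 0}\frac{\log I_\mu(q,\varepsilon)}{(q-1)\log\varepsilon}$. A subset of a topological space is residual if it contains a countable intersection of open dense sets. *)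

theory Defs
  imports "HOL-Probability.Probability"
begin

text \<open>The compact metric space is a type of class \<^class>\<open>metric_space\<close> with compact universe;
  its Borel probability measures are the elements of \<^term>\<open>space (prob_algebra borel)\<close>.\<close>

definition weak_topology :: "'a::topological_space measure topology" where
  "weak_topology = topology_generated_by
     {{\<mu> \<in> space (prob_algebra borel). (\<integral>x. f x \<partial>\<mu>) \<in> U} | f U.
        continuous_on UNIV f \<and> bounded (range f) \<and> open (U :: real set)}"

lemma topspace_weak_topology:
  "topspace weak_topology = space (prob_algebra (borel :: 'a::topological_space measure))"
proof -
  have "\<exists>f U. space (prob_algebra borel) = {\<mu> \<in> space (prob_algebra borel). (\<integral>x. f x \<partial>\<mu>) \<in> U}
      \<and> continuous_on UNIV (f :: 'a \<Rightarrow> real) \<and> bounded (range f) \<and> open U"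
    by (rule exI[of _ "\<lambda>_. 0"], rule exI[of _ UNIV]) auto
  then show ?thesis
    unfolding weak_topology_def topology_generated_by_topspace by blast
qed

definition invariant_measures :: "('a::topological_space \<Rightarrow> 'a) \<Rightarrow> 'a measure set" where
  "invariant_measures T = {\<mu> \<in> space (prob_algebra borel). distr \<mu> borel T = \<mu>}"

definition invariant_topology :: "('a::topological_space \<Rightarrow> 'a) \<Rightarrow> 'a measure topology" where
  "invariant_topology T = subtopology weak_topology (invariant_measures T)"

lemma topspace_invariant_topology: "topspace (invariant_topology T) = invariant_measures T"
  by (auto simp: invariant_topology_def topspace_weak_topology invariant_measures_def)

definition periodic_point :: "('a \<Rightarrow> 'a) \<Rightarrow> 'a \<Rightarrow> bool" where
  "periodic_point T x \<longleftrightarrow> (\<exists>k>0. (T ^^ k) x = x)"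

definition period :: "('a \<Rightarrow> 'a) \<Rightarrow> 'a \<Rightarrow> nat" where
  "period T x = (LEAST k. k > 0 \<and> (T ^^ k) x = x)"

definition orbit_measure :: "('a::topological_space \<Rightarrow> 'a) \<Rightarrow> 'a \<Rightarrow> 'a measure" where
  "orbit_measure T x = measure_of UNIV (sets borel)
     (\<lambda>A. (\<Sum>i<period T x. emeasure (return borel ((T ^^ i) x)) A) / of_nat (period T x))"

lemma sets_orbit_measure [simp]: "sets (orbit_measure T x) = sets borel"
  unfolding orbit_measure_def
  by (metis sets.sigma_sets_eq sets.space_closed sets_measure_of space_borel)

lemma emeasure_orbit_measure:
  fixes T :: "'a::topological_space \<Rightarrow> 'a"
  assumes "A \<in> sets borel"
  shows "emeasure (orbit_measure T x) A =
    (\<Sum>i<period T x. emeasure (return borel ((T ^^ i) x)) A) / of_nat (period T x)"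
proof (rule emeasure_measure_of[OF orbit_measure_def])
  let ?m = "\<lambda>A. (\<Sum>i<period T x. emeasure (return borel ((T ^^ i) x)) A) / of_nat (period T x)"
  show "sets borel \<subseteq> Pow (UNIV :: 'a set)" by simp
  show "A \<in> sets (orbit_measure T x)" using assms by simp
  show "positive (sets (orbit_measure T x)) ?m" by (simp add: positive_def)
  show "countably_additive (sets (orbit_measure T x)) ?m"
  proof (rule countably_additiveI)
    fix F :: "nat \<Rightarrow> 'a set"
    assume F: "range F \<subseteq> sets (orbit_measure T x)" "disjoint_family F"
    have eq: "(\<Sum>n. emeasure (return borel ((T ^^ i) x)) (F n))
        = emeasure (return borel ((T ^^ i) x)) (\<Union>n. F n)" for i
      using F by (intro suminf_emeasure) auto
    have "(\<Sum>n. ?m (F n)) = (\<Sum>n. \<Sum>i<period T x. emeasure (return borel ((T ^^ i) x)) (F n))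
        / of_nat (period T x)"
      by (simp add: divide_ennreal_def ennreal_suminf_multc)
    also have "(\<Sum>n. \<Sum>i<period T x. emeasure (return borel ((T ^^ i) x)) (F n))
        = (\<Sum>i<period T x. \<Sum>n. emeasure (return borel ((T ^^ i) x)) (F n))"
      by (rule suminf_sum) simp
    finally show "(\<Sum>n. ?m (F n)) = ?m (\<Union>n. F n)" by (simp add: eq)
  qed
qed

definition periodic_measures :: "('a::topological_space \<Rightarrow> 'a) \<Rightarrow> 'a measure set" where
  "periodic_measures T = {orbit_measure T x | x. periodic_point T x}"

definition measure_support :: "'a::topological_space measure \<Rightarrow> 'a set" where
  "measure_support \<mu> = {x. \<forall>U. open U \<and> x \<in> U \<longrightarrow> emeasure \<mu> U > 0}"

text \<open>As \<open>x \<mapsto> \<mu>(B(x,\<epsilon>))\<close> is lower semicontinuous, the integrand is Borel; it is positive on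
  the support and, on a compact space, bounded there (for \<open>q < 1\<close>, cover the support by finitely
  many balls of radius \<open>\<epsilon>/2\<close> centred in it). So the Bochner integral is never the default value
  \<open>0\<close> of a non-integrable function.\<close>

definition energy_integral :: "'a::metric_space measure \<Rightarrow> real \<Rightarrow> real \<Rightarrow> real" where
  "energy_integral \<mu> q \<epsilon> =
     (LINT x : measure_support \<mu> | \<mu>. measure \<mu> (ball x \<epsilon>) powr (q - 1))"

definition lower_gen_fractal_dim :: "'a::metric_space measure \<Rightarrow> real \<Rightarrow> ereal" where
  "lower_gen_fractal_dim \<mu> q =
     Liminf (at_right 0) (\<lambda>\<epsilon>. ereal (ln (energy_integral \<mu> q \<epsilon>) / ((q - 1) * ln \<epsilon>)))"

definition residual_in :: "'a topology \<Rightarrow> 'a set \<Rightarrow> bool" where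
  "residual_in X S \<longleftrightarrow> S \<subseteq> topspace X \<and>
     (\<exists>\<G>. countable \<G> \<and> (\<forall>G\<in>\<G>. openin X G \<and> X closure_of G = topspace X) \<and>
          topspace X \<inter> \<Inter>\<G> \<subseteq> S)"

end

theory Submission
  imports Defs "HOL-Real_Asymp.Real_Asymp"
begin

text \<open>For \<open>0 < s < 1\<close> the energy integral is at least \<open>1\<close>, so the lower dimension is nonnegative.
  A set \<open>A\<close> of diameter less than \<open>\<epsilon>\<close> contributes at most \<open>\<mu>(A)\<^sup>s\<close> to the energy integral at
  scale \<open>\<epsilon>\<close>. Hence, if all but mass \<open>\<delta>\<close> of \<open>\<mu>\<close> lies within \<open>\<epsilon>/2\<close> of a finite set of \<open>p\<close> points
  (a periodic orbit), the energy is at most \<open>p + N \<delta>\<^sup>s\<close>, where \<open>N\<close> counts the \<open>\<epsilon>/2\<close>-balls needed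
  to cover the space. Choosing first \<open>\<epsilon>\<close> small in terms of \<open>p\<close> and then \<open>\<delta>\<close> small in terms of \<open>N\<close>
  makes the logarithmic quotient at scale \<open>\<epsilon>\<close> small on a weak neighbourhood of the periodic
  measure. The interiors of the sets of measures with a small quotient at some small scale are
  therefore dense, and on their intersection the lower limit is \<open>0\<close>.\<close>

section \<open>Finite nets, the support, and measurability of ball masses\<close>

lemma compact_UNIV_finite_net:
  assumes "compact (UNIV :: 'a::metric_space set)" "0 < e"
  obtains N :: "'a::metric_space set" where "finite N" "(\<Union>c\<in>N. ball c e) = UNIV"
  using assms unfolding compact_eq_totally_bounded by blast

lemma closed_measure_support: "closed (measure_support \<mu>)"
proof -
  have "open (- measure_support \<mu>)"
  proof (subst open_subopen, intro ballI)
    fix x assume "x \<in> - measure_support \<mu>"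
    then obtain U where U: "open U" "x \<in> U" "\<not> emeasure \<mu> U > 0"
      by (auto simp: measure_support_def)
    then have "U \<subseteq> - measure_support \<mu>"
      by (auto simp: measure_support_def)
    with U show "\<exists>U. open U \<and> x \<in> U \<and> U \<subseteq> - measure_support \<mu>" by blast
  qed
  then show ?thesis by (simp add: closed_def)
qed

text \<open>The complement of the support is a union of null open sets, possibly uncountably many.
  Finite nets at the scales \<open>1 / Suc n\<close> supply countably many balls, and every point
  off the support lies in a null one.\<close>

lemma AE_in_measure_support:
  fixes \<mu> :: "'a::metric_space measure"
  assumes comp: "compact (UNIV :: 'a set)" and sets: "sets \<mu> = sets borel"
  shows "AE x in \<mu>. x \<in> measure_support \<mu>"
proof -
  have "\<exists>N :: 'a set. finite N \<and> (\<Union>c\<in>N. ball c (1 / Suc n)) = UNIV" for n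
    by (rule compact_UNIV_finite_net[OF comp, of "1 / Suc n"]) (simp, blast)
  then obtain N :: "nat \<Rightarrow> 'a set" where
    N: "\<And>n. finite (N n)" "\<And>n. (\<Union>c\<in>N n. ball c (1 / Suc n)) = UNIV"
    by metis
  define Z where "Z = {(n, c). c \<in> N n \<and> emeasure \<mu> (ball c (1 / Suc n)) = 0}"
  have "Z \<subseteq> Sigma UNIV N" by (auto simp: Z_def)
  moreover have "countable (Sigma UNIV N)"
    by (intro countable_SIGMA) (auto simp: N countable_finite)
  ultimately have "countable Z" by (rule countable_subset)
  then have "(\<Union>(n, c)\<in>Z. ball c (1 / Suc n)) \<in> null_sets \<mu>"
    by (intro null_sets_UN') (auto simp: Z_def null_sets_def sets)
  moreover have "x \<in> (\<Union>(n, c)\<in>Z. ball c (1 / Suc n))" if x: "x \<notin> measure_support \<mu>" for x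
  proof -
    obtain U where U: "open U" "x \<in> U" "emeasure \<mu> U = 0"
      using x by (auto simp: measure_support_def)
    then obtain r where r: "0 < r" "ball x r \<subseteq> U" by (auto elim: openE)
    \<comment> \<open>With half of \<open>r\<close>, a net ball that contains \<open>x\<close> stays
      inside \<open>ball x r\<close>, although \<open>x\<close> need not be its centre.\<close>
    obtain n where n: "1 / Suc n < r / 2"
      using nat_approx_posE[of "r / 2"] r(1) by auto
    obtain c where c: "c \<in> N n" "x \<in> ball c (1 / Suc n)" using N(2)[of n] by blast
    have "ball c (1 / Suc n) \<subseteq> ball x r"
    proof
      fix y assume "y \<in> ball c (1 / Suc n)"
      then show "y \<in> ball x r"
        using c(2) n dist_triangle[of x y c] by (simp add: dist_commute)
    qed
    with r(2) have "emeasure \<mu> (ball c (1 / Suc n)) \<le> emeasure \<mu> U"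
      using U(1) by (intro emeasure_mono) (auto simp: sets)
    with U(3) c show ?thesis by (auto simp: Z_def)
  qed
  ultimately show ?thesis by (intro AE_I') auto
qed

text \<open>Lower semicontinuity: by continuity from below, a ball of mass above \<open>a\<close>
  can be shrunk by some \<open>1 / Suc n\<close> and keep mass above \<open>a\<close>. The shrunken
  ball lies in \<open>ball y e\<close> for every \<open>y\<close> within \<open>1 / Suc n\<close> of
  \<open>x\<close>, so the superlevel sets are open.\<close>

lemma borel_measurable_measure_ball:
  fixes M :: "'a::metric_space measure"
  assumes "finite_measure M" and sets: "sets M = sets borel"
  shows "(\<lambda>x. measure M (ball x e)) \<in> borel_measurable borel"
proof (rule borel_measurableI_greater)
  interpret finite_measure M by fact
  fix a :: real
  have "open {x. a < measure M (ball x e)}"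
  proof (subst open_subopen, intro ballI)
    fix x assume "x \<in> {x. a < measure M (ball x e)}"
    then have x: "a < measure M (ball x e)" by simp
    have "(\<lambda>n. measure M (ball x (e - 1 / Suc n))) \<longlonglongrightarrow> measure M (\<Union>n. ball x (e - 1 / Suc n))"
      by (rule finite_Lim_measure_incseq)
        (auto simp: sets incseq_def frac_le intro!: subset_ball)
    also have "(\<Union>n. ball x (e - 1 / Suc n)) = ball x e"
    proof (intro equalityI subsetI)
      fix y assume "y \<in> ball x e"
      then obtain n where "1 / Suc n < e - dist x y"
        using nat_approx_posE[of "e - dist x y"] by auto
      then show "y \<in> (\<Union>n. ball x (e - 1 / Suc n))" by (auto intro!: exI[of _ n])
    next
      fix y assume "y \<in> (\<Union>n. ball x (e - 1 / Suc n))"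
      then obtain n where "dist x y < e - 1 / Suc n" by auto
      also have "\<dots> < e" by simp
      finally show "y \<in> ball x e" by simp
    qed
    finally have "\<forall>\<^sub>F n in sequentially. a < measure M (ball x (e - 1 / Suc n))"
      using x by (rule order_tendstoD)
    then obtain n where n: "a < measure M (ball x (e - 1 / Suc n))"
      by (auto simp: eventually_sequentially)
    have "ball x (1 / Suc n) \<subseteq> {x. a < measure M (ball x e)}"
    proof
      fix y assume y: "y \<in> ball x (1 / Suc n)"
      have "ball x (e - 1 / Suc n) \<subseteq> ball y e"
      proof
        fix z assume "z \<in> ball x (e - 1 / Suc n)"
        then show "z \<in> ball y e"
          using y dist_triangle[of y z x] by (simp add: dist_commute)
      qed
      then have "measure M (ball x (e - 1 / Suc n)) \<le> measure M (ball y e)"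
        by (intro finite_measure_mono) (auto simp: sets)
      with n show "y \<in> {x. a < measure M (ball x e)}" by simp
    qed
    then show "\<exists>V. open V \<and> x \<in> V \<and> V \<subseteq> {x. a < measure M (ball x e)}"
      by (intro exI[of _ "ball x (1 / Suc n)"]) auto
  qed
  then show "{x \<in> space borel. a < measure M (ball x e)} \<in> sets borel" by simp
qed

section \<open>Bounds on the energy integral\<close>

lemma prob_algebra_borelD:
  assumes "\<mu> \<in> space (prob_algebra borel)"
  shows "prob_space \<mu>" "sets \<mu> = sets borel" "space \<mu> = UNIV"
  using assms sets_eq_imp_space_eq[of \<mu> borel] by (auto simp: space_prob_algebra)

text \<open>For \<open>x\<close> in \<open>A\<close> the ball contains \<open>A\<close>. As
  \<open>q - 1\<close> is negative, the integrand there is at most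
  \<open>measure \<mu> A powr (q - 1)\<close>, and integrating over \<open>A\<close> supplies one
  more factor \<open>measure \<mu> A\<close>.\<close>

lemma nn_integral_energy_small_set:
  fixes \<mu> :: "'a::metric_space measure"
  assumes "prob_space \<mu>" and sets: "sets \<mu> = sets borel"
    and q: "q < 1" and A: "A \<in> sets borel" and diam: "\<And>x y. x \<in> A \<Longrightarrow> y \<in> A \<Longrightarrow> dist x y < e"
  shows "(\<integral>\<^sup>+x. ennreal (measure \<mu> (ball x e) powr (q - 1)) * indicator A x \<partial>\<mu>)
    \<le> ennreal (measure \<mu> A powr q)"
proof -
  interpret prob_space \<mu> by fact
  define m where "m = measure \<mu> A"
  show ?thesis
  proof (cases "m = 0")
    \<comment> \<open>A null \<open>A\<close> needs its own argument: \<open>0 powr (q - 1)\<close>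
      is 0, so the comparison of powers breaks down at mass 0.\<close>
    case True
    then have "A \<in> null_sets \<mu>"
      using A by (auto simp: m_def null_sets_def sets emeasure_eq_measure)
    then have "(\<integral>\<^sup>+x. ennreal (measure \<mu> (ball x e) powr (q - 1)) * indicator A x \<partial>\<mu>) = 0"
      by (rule nn_integral_null_set)
    then show ?thesis by simp
  next
    case False
    then have m: "m > 0" by (simp add: m_def order_less_le)
    have "(\<integral>\<^sup>+x. ennreal (measure \<mu> (ball x e) powr (q - 1)) * indicator A x \<partial>\<mu>)
        \<le> (\<integral>\<^sup>+x. ennreal (m powr (q - 1)) * indicator A x \<partial>\<mu>)"
    proof (intro nn_integral_mono)
      fix x
      have "measure \<mu> (ball x e) powr (q - 1) \<le> m powr (q - 1)" if "x \<in> A"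
      proof -
        have "m \<le> measure \<mu> (ball x e)"
          unfolding m_def using diam[OF that] by (intro finite_measure_mono) (auto simp: sets)
        with m q show ?thesis by (intro powr_mono2') auto
      qed
      then show "ennreal (measure \<mu> (ball x e) powr (q - 1)) * indicator A x
          \<le> ennreal (m powr (q - 1)) * indicator A x"
        by (auto simp: indicator_def intro!: ennreal_leI)
    qed
    also have "\<dots> = ennreal (m powr (q - 1)) * ennreal m"
      using A by (simp add: nn_integral_cmult_indicator sets emeasure_eq_measure m_def)
    also have "\<dots> = ennreal (m powr q)"
      using m by (simp add: ennreal_mult'[symmetric] powr_diff)
    finally show ?thesis by (simp add: m_def)
  qed
qed

text \<open>The bound for small sets is summed over a cover, which may overlap since the integrand
  is nonnegative. Working with \<open>nn_integral\<close> first yields integrability, so that the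
  Bochner integral is not a default 0; restricting to the support then only lowers it.\<close>

lemma energy_integral_cover:
  fixes \<mu> :: "'a::metric_space measure"
  assumes prob: "prob_space \<mu>" and sets: "sets \<mu> = sets borel" and q: "q < 1"
    and F: "finite F" "\<Union>F = UNIV" "F \<subseteq> sets borel"
    and diam: "\<And>A x y. A \<in> F \<Longrightarrow> x \<in> A \<Longrightarrow> y \<in> A \<Longrightarrow> dist x y < e"
  shows "integrable \<mu> (\<lambda>x. measure \<mu> (ball x e) powr (q - 1))" (is "integrable \<mu> ?g")
    and "energy_integral \<mu> q e \<le> (\<Sum>A\<in>F. measure \<mu> A powr q)"
proof -
  interpret prob_space \<mu> by fact
  note sets [measurable_cong]
  note borel_measurable_measure_ball[OF finite_measure_axioms sets, measurable]
  have "(\<integral>\<^sup>+x. ennreal (?g x) \<partial>\<mu>) \<le> (\<integral>\<^sup>+x. (\<Sum>A\<in>F. ennreal (?g x) * indicator A x) \<partial>\<mu>)"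
  proof (intro nn_integral_mono)
    fix x
    obtain A where A: "A \<in> F" "x \<in> A" using F(2) by blast
    then have "ennreal (?g x) = ennreal (?g x) * indicator A x" by simp
    also have "\<dots> \<le> (\<Sum>A\<in>F. ennreal (?g x) * indicator A x)"
      using A F(1) by (intro member_le_sum) auto
    finally show "ennreal (?g x) \<le> (\<Sum>A\<in>F. ennreal (?g x) * indicator A x)" .
  qed
  also have "\<dots> = (\<Sum>A\<in>F. \<integral>\<^sup>+x. ennreal (?g x) * indicator A x \<partial>\<mu>)"
    using F(3) by (intro nn_integral_sum) (measurable, auto simp: sets)
  also have "\<dots> \<le> (\<Sum>A\<in>F. ennreal (measure \<mu> A powr q))"
    using F(3) diam q by (intro sum_mono nn_integral_energy_small_set[OF prob sets]) auto
  also have "\<dots> = ennreal (\<Sum>A\<in>F. measure \<mu> A powr q)" by (simp add: sum_ennreal)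
  finally have bound: "(\<integral>\<^sup>+x. ennreal (?g x) \<partial>\<mu>) \<le> ennreal (\<Sum>A\<in>F. measure \<mu> A powr q)" .
  then have "(\<integral>\<^sup>+x. ennreal (?g x) \<partial>\<mu>) < \<infinity>"
    by (simp add: order_le_less_trans)
  then show int: "integrable \<mu> ?g" by (intro integrableI_nonneg) auto
  have "energy_integral \<mu> q e \<le> integral\<^sup>L \<mu> ?g"
    unfolding energy_integral_def set_lebesgue_integral_def
    using closed_measure_support[of \<mu>]
    by (intro integral_mono int integrable_mult_indicator)
      (auto simp: sets indicator_def borel_closed)
  also have "\<dots> \<le> (\<Sum>A\<in>F. measure \<mu> A powr q)"
    using bound nn_integral_eq_integral[OF int]
    by (simp add: ennreal_le_iff sum_nonneg)
  finally show "energy_integral \<mu> q e \<le> (\<Sum>A\<in>F. measure \<mu> A powr q)" .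
qed

lemma dist_less_if_in_half_ball:
  assumes "x \<in> ball c (e / 2)" "y \<in> ball c (e / 2)"
  shows "dist x y < e"
  using assms dist_triangle_half_r[of c x e y] by simp

text \<open>A ball of positive mass at most 1 gives an integrand of at least 1, because the exponent
  is negative. This covers all of the support, which has full measure.\<close>

lemma energy_integral_ge_1:
  fixes \<mu> :: "'a::metric_space measure"
  assumes comp: "compact (UNIV :: 'a set)" and prob: "prob_space \<mu>"
    and sets: "sets \<mu> = sets borel" and q: "q < 1" and e: "0 < e"
  shows "1 \<le> energy_integral \<mu> q e"
proof -
  interpret prob_space \<mu> by fact
  let ?g = "\<lambda>x. measure \<mu> (ball x e) powr (q - 1)"
  obtain N :: "'a set" where N: "finite N" "(\<Union>c\<in>N. ball c (e / 2)) = UNIV"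
    using compact_UNIV_finite_net[OF comp, of "e / 2"] e by auto
  have int: "integrable \<mu> ?g"
    using N q by (intro energy_integral_cover(1)[OF prob sets, of _ "(\<lambda>c. ball c (e / 2)) ` N"])
      (auto intro: dist_less_if_in_half_ball simp del: mem_ball)
  have supp: "measure_support \<mu> \<in> sets \<mu>"
    using closed_measure_support[of \<mu>] by (simp add: sets borel_closed)
  have "1 = (\<integral>x. (1::real) \<partial>\<mu>)" by (simp add: prob_space)
  also have "\<dots> \<le> energy_integral \<mu> q e"
    unfolding energy_integral_def set_lebesgue_integral_def
  proof (intro integral_mono_AE integrable_mult_indicator int supp)
    show "AE x in \<mu>. 1 \<le> indicator (measure_support \<mu>) x *\<^sub>R ?g x"
      using AE_in_measure_support[OF comp sets]
    proof eventually_elim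
      case (elim x)
      then have "emeasure \<mu> (ball x e) > 0" using e by (auto simp: measure_support_def)
      then have "measure \<mu> (ball x e) > 0" by (simp add: emeasure_eq_measure)
      then have "1 powr (q - 1) \<le> ?g x" using q by (intro powr_mono2') auto
      with elim show ?case by simp
    qed
  qed simp
  finally show ?thesis .
qed

section \<open>The lower dimension and quotients at small scales\<close>

lemma lower_gen_fractal_dim_nonneg:
  fixes \<mu> :: "'a::metric_space measure"
  assumes "compact (UNIV :: 'a set)" "prob_space \<mu>" "sets \<mu> = sets borel" "q < 1"
  shows "0 \<le> lower_gen_fractal_dim \<mu> q"
  unfolding lower_gen_fractal_dim_def
proof (rule Liminf_bounded)
  have "\<forall>\<^sub>F e in at_right 0. 0 < e \<and> e < (1::real)"
    by (auto simp: eventually_at_right_field intro: exI[of _ 1])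
  then show "\<forall>\<^sub>F e in at_right 0. 0 \<le> ereal (ln (energy_integral \<mu> q e) / ((q - 1) * ln e))"
  proof eventually_elim
    case (elim e)
    have "0 \<le> ln (energy_integral \<mu> q e)"
      using energy_integral_ge_1[OF assms, of e] elim by simp
    moreover have "0 < (q - 1) * ln e"
      using elim assms(4) by (intro mult_neg_neg) auto
    ultimately show ?case by simp
  qed
qed

text \<open>A lower limit is controlled by arbitrarily small scales, so one good scale per
  \<open>\<eta>\<close> is enough. The same \<open>\<eta>\<close> bounds the scale and the quotient,
  which leaves a single sequence of conditions.\<close>

definition small_quotient :: "real \<Rightarrow> real \<Rightarrow> 'a::metric_space measure set" where
  "small_quotient q \<eta> =
    {\<mu>. \<exists>e. 0 < e \<and> e < \<eta> \<and> ln (energy_integral \<mu> q e) / ((q - 1) * ln e) < \<eta>}"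

lemma lower_gen_fractal_dim_le_0:
  assumes "\<And>n. \<mu> \<in> small_quotient q (1 / Suc n)"
  shows "lower_gen_fractal_dim \<mu> q \<le> 0"
proof (rule ccontr)
  let ?f = "\<lambda>e. ln (energy_integral \<mu> q e) / ((q - 1) * ln e)"
  assume "\<not> ?thesis"
  then have "0 < lower_gen_fractal_dim \<mu> q" by simp
  then obtain a where a: "0 < ereal a" "ereal a < lower_gen_fractal_dim \<mu> q"
    using ereal_dense2 by blast
  then have "\<forall>\<^sub>F e in at_right 0. a < ?f e"
    using less_LiminfD[of "ereal a" "at_right 0" "\<lambda>e. ereal (?f e)"]
    by (simp add: lower_gen_fractal_dim_def)
  then obtain b where b: "0 < b" "\<And>e. 0 < e \<Longrightarrow> e < b \<Longrightarrow> a < ?f e"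
    by (auto simp: eventually_at_right_field)
  \<comment> \<open>Below \<open>b\<close> the scale falls in the range where the quotient exceeds
    \<open>a\<close>; below \<open>a\<close> this contradicts the small quotient.\<close>
  obtain n where n: "1 / Suc n < min a b"
    using nat_approx_posE[of "min a b"] a(1) b(1) by auto
  obtain e where "0 < e" "e < 1 / Suc n" "?f e < 1 / Suc n"
    using assms[of n] by (auto simp: small_quotient_def)
  then show False using b(2)[of e] n by linarith
qed

section \<open>Weak neighbourhoods of periodic measures\<close>

lemma openin_weak_integral_gt:
  fixes f :: "'a::topological_space \<Rightarrow> real"
  assumes "continuous_on UNIV f" "bounded (range f)"
  shows "openin (invariant_topology T) {\<mu> \<in> invariant_measures T. a < (\<integral>x. f x \<partial>\<mu>)}"
proof -
  have "openin weak_topology {\<mu> \<in> space (prob_algebra borel). (\<integral>x. f x \<partial>\<mu>) \<in> {a<..}}"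
    unfolding weak_topology_def
    by (rule topology_generated_by_Basis, rule CollectI, rule exI[of _ f], rule exI[of _ "{a<..}"])
      (simp add: assms)
  moreover have "{\<mu> \<in> invariant_measures T. a < (\<integral>x. f x \<partial>\<mu>)}
      = {\<mu> \<in> space (prob_algebra borel). (\<integral>x. f x \<partial>\<mu>) \<in> {a<..}} \<inter> invariant_measures T"
    by (auto simp: invariant_measures_def)
  ultimately show ?thesis
    unfolding invariant_topology_def openin_subtopology by blast
qed

lemma integral_orbit_measure_eq_1:
  fixes f :: "'a::t1_space \<Rightarrow> real"
  assumes "prob_space (orbit_measure T x)" and f: "\<And>i. f ((T ^^ i) x) = 1"
    and meas: "f \<in> borel_measurable borel"
  shows "(\<integral>y. f y \<partial>orbit_measure T x) = 1"
proof -
  interpret prob_space "orbit_measure T x" by fact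
  define O' where "O' = (\<lambda>i. (T ^^ i) x) ` {..<period T x}"
  have "closed O'" by (auto simp: O'_def intro: finite_imp_closed)
  then have cO: "- O' \<in> sets borel" by (auto intro: borel_open)
  \<comment> \<open>Every Dirac mass in the average sits at a point of \<open>O'\<close>.\<close>
  have "emeasure (orbit_measure T x) (- O') = 0"
    using cO by (simp add: emeasure_orbit_measure O'_def)
  then have "- O' \<in> null_sets (orbit_measure T x)" using cO by (auto simp: null_sets_def)
  then have "AE y in orbit_measure T x. f y = 1"
    by (rule AE_I') (auto simp: O'_def f)
  then have "(\<integral>y. f y \<partial>orbit_measure T x) = (\<integral>y. 1 \<partial>orbit_measure T x)"
    using meas by (intro integral_cong_AE) (auto cong: measurable_cong_sets)
  then show ?thesis by (simp add: prob_space)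
qed

text \<open>The space is covered by the balls around \<open>P\<close>, each contributing at most 1,
  and by the net balls with \<open>U\<close> removed. The latter lie in the complement of
  \<open>U\<close>, so each has mass at most \<open>d\<close> and contributes at most
  \<open>d powr q\<close>.\<close>

lemma energy_integral_concentrated:
  fixes \<mu> :: "'a::metric_space measure"
  assumes prob: "prob_space \<mu>" and sets: "sets \<mu> = sets borel" and q: "0 < q" "q < 1"
    and P: "finite P" and N: "finite N" "(\<Union>c\<in>N. ball c (e / 2)) = (UNIV :: 'a set)"
    and d: "measure \<mu> (- (\<Union>c\<in>P. ball c (e / 2))) \<le> d"
  shows "energy_integral \<mu> q e \<le> card P + card N * d powr q"
proof -
  interpret prob_space \<mu> by fact
  define U where "U = (\<Union>c\<in>P. ball c (e / 2))"
  have U: "open U" by (auto simp: U_def)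
  let ?A = "(\<lambda>c. ball c (e / 2)) ` P" and ?B = "(\<lambda>c. ball c (e / 2) - U) ` N"
  have "energy_integral \<mu> q e \<le> (\<Sum>A\<in>?A \<union> ?B. measure \<mu> A powr q)"
  proof (rule energy_integral_cover(2)[OF prob sets])
    show "\<Union> (?A \<union> ?B) = UNIV" using N(2) by (auto simp: U_def simp del: mem_ball)
    show "?A \<union> ?B \<subseteq> sets borel" using U by auto
    show "\<And>A x y. A \<in> ?A \<union> ?B \<Longrightarrow> x \<in> A \<Longrightarrow> y \<in> A \<Longrightarrow> dist x y < e"
      by (auto intro: dist_less_if_in_half_ball simp del: mem_ball)
  qed (use P N q in auto)
  also have "\<dots> \<le> (\<Sum>A\<in>?A. measure \<mu> A powr q) + (\<Sum>A\<in>?B. measure \<mu> A powr q)"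
    using P N(1) by (subst sum_Un) (auto intro!: sum_nonneg)
  also have "(\<Sum>A\<in>?A. measure \<mu> A powr q) \<le> card P"
  proof -
    have "(\<Sum>A\<in>?A. measure \<mu> A powr q) \<le> of_nat (card ?A) * 1"
      using q by (intro sum_bounded_above) (auto intro!: powr_le1)
    also have "\<dots> \<le> card P" using P by (simp add: card_image_le)
    finally show ?thesis .
  qed
  also have "(\<Sum>A\<in>?B. measure \<mu> A powr q) \<le> card N * d powr q"
  proof -
    have "measure \<mu> A \<le> d" if "A \<in> ?B" for A
    proof -
      have "measure \<mu> A \<le> measure \<mu> (- U)"
        using that U by (intro finite_measure_mono) (auto simp: sets)
      with d show ?thesis by (simp add: U_def)
    qed
    then have "(\<Sum>A\<in>?B. measure \<mu> A powr q) \<le> of_nat (card ?B) * d powr q"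
      using q by (intro sum_bounded_above) (auto intro!: powr_mono2)
    also have "\<dots> \<le> card N * d powr q"
      using N(1) by (intro mult_right_mono) (auto simp: card_image_le)
    finally show ?thesis .
  qed
  finally show ?thesis by simp
qed

lemma orbit_measure_in_interior_small_quotient:
  fixes T :: "'a::metric_space \<Rightarrow> 'a"
  assumes comp: "compact (UNIV :: 'a set)" and q: "0 < q" "q < 1" and \<eta>: "0 < \<eta>"
    and per: "periodic_point T x" and inv: "orbit_measure T x \<in> invariant_measures T"
  shows "orbit_measure T x \<in> invariant_topology T interior_of (small_quotient q \<eta>)"
proof -
  \<comment> \<open>Any positive return time will do: \<open>P\<close> only has to be finite and
    contain the whole orbit.\<close>
  obtain k where k: "k > 0" "(T ^^ k) x = x" using per by (auto simp: periodic_point_def)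
  define P where "P = (\<lambda>i. (T ^^ i) x) ` {..<k}"
  have P: "finite P" "P \<noteq> {}" using k(1) by (auto simp: P_def)
  have orbit: "(T ^^ i) x \<in> P" for i
    using k(1) funpow_mod_eq[OF k(2), of i] unfolding P_def
    by (metis imageI lessThan_iff mod_less_divisor)
  \<comment> \<open>The intended energy bound \<open>card P + 1\<close> does not depend on
    \<open>e\<close>, while \<open>ln e\<close> diverges.\<close>
  have "((\<lambda>e. ln (card P + 1) / ((q - 1) * ln e)) \<longlongrightarrow> 0) (at_right 0)"
    using q by real_asymp
  then have "\<forall>\<^sub>F e in at_right 0. ln (card P + 1) / ((q - 1) * ln e) < \<eta>"
    using \<eta> by (rule order_tendstoD)
  then obtain b where b: "0 < b"
      "\<And>e. 0 < e \<Longrightarrow> e < b \<Longrightarrow> ln (card P + 1) / ((q - 1) * ln e) < \<eta>"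
    by (auto simp: eventually_at_right_field)
  define e where "e = min (min b \<eta>) 1 / 2"
  have e: "0 < e" "e < b" "e < \<eta>" "e < 1" using b(1) \<eta> by (auto simp: e_def)
  obtain N :: "'a set" where N: "finite N" "(\<Union>c\<in>N. ball c (e / 2)) = UNIV"
    using compact_UNIV_finite_net[OF comp, of "e / 2"] e(1) by auto
  \<comment> \<open>The net depends on \<open>e\<close>, so \<open>d\<close> is chosen after it,
    with \<open>d powr q = 1 / (card N + 1)\<close>: the part away from the orbit then adds at most
    1 to the energy.\<close>
  define d where "d = (1 / (card N + 1)) powr (1 / q)"
  have d: "0 < d" by (simp add: d_def)
  have "d powr q = 1 / (card N + 1)"
    unfolding d_def using q by (subst powr_powr) simp
  then have Nd: "card N * d powr q \<le> 1" by simp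
  \<comment> \<open>Weak neighbourhoods test continuous functions, not masses of balls. This tent
    function is 1 on \<open>P\<close> and lies below the indicator of the balls around
    \<open>P\<close>, so a large integral forces a large mass there.\<close>
  define f where "f = (\<lambda>y. max 0 (1 - infdist y P / (e / 2)))"
  have cont: "continuous_on UNIV f" unfolding f_def by (intro continuous_intros) (use e in auto)
  have f01: "0 \<le> f y" "f y \<le> 1" for y
    using e infdist_nonneg[of y P] by (auto simp: f_def)
  have fb: "bounded (range f)"
    using f01 by (auto simp: bounded_iff intro!: exI[of _ 1])
  have f_supp: "f y \<le> indicator (\<Union>c\<in>P. ball c (e / 2)) y" for y
  proof (cases "y \<in> (\<Union>c\<in>P. ball c (e / 2))")
    case False
    then have "e / 2 \<le> dist y c" if "c \<in> P" for c
      using that by (auto simp: not_less dist_commute)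
    then have "e / 2 \<le> infdist y P"
      unfolding infdist_notempty[OF P(2)] by (intro cINF_greatest P(2))
    then show ?thesis using False e(1) by (simp add: f_def field_simps)
  qed (use f01 in auto)
  let ?V = "{\<mu> \<in> invariant_measures T. 1 - d < (\<integral>x. f x \<partial>\<mu>)}"
  have "?V \<subseteq> small_quotient q \<eta>"
  proof
    fix \<mu> assume \<mu>: "\<mu> \<in> ?V"
    then have *: "prob_space \<mu>" "sets \<mu> = sets borel" "space \<mu> = UNIV"
      using prob_algebra_borelD[of \<mu>] by (auto simp: invariant_measures_def)
    interpret prob_space \<mu> by (rule *(1))
    have U: "(\<Union>c\<in>P. ball c (e / 2)) \<in> sets \<mu>"
      unfolding *(2) by (intro borel_open open_UN ballI open_ball)
    have fint: "integrable \<mu> f"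
      using f01 cont *(2)
      by (intro integrable_const_bound[of _ 1])
        (auto intro!: borel_measurable_continuous_onI cong: measurable_cong_sets)
    have "(\<integral>x. f x \<partial>\<mu>) \<le> (\<integral>x. indicator (\<Union>c\<in>P. ball c (e / 2)) x \<partial>\<mu>)"
      using U by (intro integral_mono fint f_supp) (auto simp: emeasure_eq_measure)
    also have "\<dots> = measure \<mu> (\<Union>c\<in>P. ball c (e / 2))" by (simp add: *(3))
    also have "\<dots> = 1 - measure \<mu> (- (\<Union>c\<in>P. ball c (e / 2)))"
      using prob_compl[OF U] *(3) by (simp add: Compl_eq_Diff_UNIV)
    finally have "measure \<mu> (- (\<Union>c\<in>P. ball c (e / 2))) \<le> d" using \<mu> by simp
    from energy_integral_concentrated[OF *(1,2) q P(1) N this] Nd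
    have "energy_integral \<mu> q e \<le> card P + 1" by simp
    moreover have "1 \<le> energy_integral \<mu> q e"
      using energy_integral_ge_1[OF comp *(1,2) q(2) e(1)] .
    \<comment> \<open>The lower bound 1 keeps the argument of \<open>ln\<close> positive, as
      monotonicity requires.\<close>
    ultimately have "ln (energy_integral \<mu> q e) \<le> ln (card P + 1)" by simp
    moreover have "0 < (q - 1) * ln e" using e q by (intro mult_neg_neg) auto
    ultimately have "ln (energy_integral \<mu> q e) / ((q - 1) * ln e)
        \<le> ln (card P + 1) / ((q - 1) * ln e)"
      by (intro divide_right_mono) auto
    also have "\<dots> < \<eta>" using b(2) e by blast
    finally show "\<mu> \<in> small_quotient q \<eta>" using e by (auto simp: small_quotient_def)
  qed
  moreover have "openin (invariant_topology T) ?V"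
    by (rule openin_weak_integral_gt[OF cont fb])
  moreover have "(\<integral>y. f y \<partial>orbit_measure T x) = 1"
  proof (rule integral_orbit_measure_eq_1)
    show "prob_space (orbit_measure T x)"
      using inv prob_algebra_borelD(1) by (auto simp: invariant_measures_def)
    show "f ((T ^^ i) x) = 1" for i using orbit by (simp add: f_def)
    show "f \<in> borel_measurable borel" using cont by (rule borel_measurable_continuous_onI)
  qed
  ultimately show ?thesis using inv d by (auto simp: interior_of_def intro!: exI[of _ ?V])
qed

section \<open>Density of the interiors and residuality\<close>

theorem theorem1p2:
  fixes T :: "'a::metric_space \<Rightarrow> 'a" and s :: real
  assumes "compact (UNIV :: 'a set)"
    and "continuous_on UNIV T"
    and "invariant_topology T closure_of periodic_measures T = invariant_measures T"
    and "0 < s" and "s < 1"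
  shows "residual_in (invariant_topology T)
    {\<mu> \<in> invariant_measures T. lower_gen_fractal_dim \<mu> s = 0}"
proof -
  let ?X = "invariant_topology T"
  \<comment> \<open>Taking interiors makes openness automatic, so only density is left to
    show.\<close>
  define G where "G = (\<lambda>n::nat. ?X interior_of (small_quotient s (1 / Suc n)))"
  have dense: "?X closure_of G n = topspace ?X" for n
  proof -
    \<comment> \<open>Only orbit measures known to be invariant are treated. By
      \<open>closure_of_restrict\<close> the closure depends only on the trace on the topspace, so
      the density hypothesis still applies.\<close>
    have "topspace ?X \<inter> periodic_measures T \<subseteq> G n"
      unfolding G_def
      using assms orbit_measure_in_interior_small_quotient[of s "1 / Suc n" T]
      by (auto simp: periodic_measures_def topspace_invariant_topology)
    then have "?X closure_of (topspace ?X \<inter> periodic_measures T) \<subseteq> ?X closure_of G n"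
      by (rule closure_of_mono)
    then show ?thesis
      using assms(3) closure_of_subset_topspace[of ?X "G n"]
      by (metis closure_of_restrict topspace_invariant_topology subset_antisym)
  qed
  have "lower_gen_fractal_dim \<mu> s = 0"
    if \<mu>: "\<mu> \<in> invariant_measures T" "\<And>n. \<mu> \<in> G n" for \<mu>
  proof (rule antisym)
    show "lower_gen_fractal_dim \<mu> s \<le> 0"
      using \<mu>(2) interior_of_subset[of ?X] unfolding G_def
      by (intro lower_gen_fractal_dim_le_0) (rule subsetD)
    show "0 \<le> lower_gen_fractal_dim \<mu> s"
      using \<mu>(1) assms(1,5) prob_algebra_borelD[of \<mu>]
      by (intro lower_gen_fractal_dim_nonneg) (auto simp: invariant_measures_def)
  qed
  then show ?thesis
    unfolding residual_in_def using dense
    by (intro conjI exI[of _ "range G"]) (auto simp: G_def topspace_invariant_topology)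
qed

end
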